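(* Let $X\subset\mathbb{R}^n$ be compact and convex, let $Y=\{y_1,\dots,y_N\}\subset\mathbb{R}^n$ be a set of $N$ points, let $\rho$ be a probability measure on $X$, absolutely continuous with respect to Lebesgue measure, whose density satisfies $0<\underline{m}\le\rho(x)\le\overline{m}<\infty$ on $X$ for some constants $\underline{m},\overline{m}$, and let $\mu=\sum_{k=1}^N\mu_k\delta_{y_k}$ be a probability measure with $\mu_k\ge\underline{\mu}>0$ for all $k$. Let $c:X\times Y\to\mathbb{R}$ be of class $C^1$ in $x$ and such that for every $x_0\in X$ the map $Y\ni y\mapsto\nabla_x c(x_0,y)$ is injective. Then for every $t\in[0,1)$ there exists $\widehat{C}=\widehat{C}(t)>0$ such that for every $\widehat\psi\in U$ $$\nabla^{2,\perp}_{\psi,\psi}\Phi(\widehat\psi,t)\succeq \widehat{C}\,\mathrm{Id}_{N-1}>0,$$ that is, $\langle v,\nabla^2_{\psi,\psi}\Phi(\widehat\psi,t)v\rangle\ge\widehat{C}\|v\|_2^2$ for all $v\in\mathbb{R}^N$ with $\sum_k v_k=0$, where $$\nabla^2_{\psi,\psi}\Phi(\widehat\psi,t)=\frac{1}{1-t}\int_X\Big(\mathrm{diag}(\pi(x))-\pi(x)\otimes\pi(x)\Big)\,d\rho(x),\qquad \pi_i(x)=\frac{e^{\frac{\widehat\psi_i-tc(x,y_i)}{1-t}}}{\sum_{k=1}^N e^{\frac{\widehat\psi_k-tc(x,y_k)}{1-t}}}.$$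
   Context: For $\psi\in\mathbb{R}^N$ and $t\in[0,1)$, the dual functional of regularized semi-discrete optimal transport is $$\Phi(\psi,t)=\int_X(1-t)\log\Big[\sum_{k=1}^N e^{\frac{\psi_k-tc(x,y_k)}{1-t}}\Big]d\rho(x)-\sum_{k=1}^N\psi_k\mu_k-(1-t).$$ Set $\|c\|_\infty=\max_{X\times Y}|c|$ and $U=\{\psi\in\mathbb{R}^N:\ \|\psi\|\le 2\|c\|_\infty,\ \sum_{i=1}^N\psi_i=0\}$, with $\|\psi\|=\max_i|\psi_i|$. $\nabla^2_{\psi,\psi}\Phi$ is the Hessian in $\psi$, and $\nabla^{2,\perp}_{\psi,\psi}\Phi$ is its restriction (as a quadratic form) to $\{v\in\mathbb{R}^N:\sum_k v_k=0\}$. *)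

theory Defs
  imports "HOL-Probability.Probability"
begin

text \<open>The map \<open>h\<close> below is the gradient field of \<open>f\<close> near \<open>x\<close>; both it (as a germ) and \<open>H\<close> are
  unique, so this says that \<open>f\<close> is twice Frechet differentiable at \<open>x\<close> with Hessian matrix \<open>H\<close>.\<close>

definition has_hessian :: "(real ^ 'k \<Rightarrow> real) \<Rightarrow> real ^ 'k ^ 'k \<Rightarrow> real ^ 'k \<Rightarrow> bool" where
  "has_hessian f H x \<longleftrightarrow>
     (\<exists>h. (\<forall>\<^sub>F z in nhds x. GDERIV f z :> h z) \<and> (h has_derivative (\<lambda>v. H *v v)) (at x))"

definition hessian :: "(real ^ 'k \<Rightarrow> real) \<Rightarrow> real ^ 'k \<Rightarrow> real ^ 'k ^ 'k" where
  "hessian f x = (THE H. has_hessian f H x)"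

lemma has_hessian_unique:
  assumes "has_hessian f H x" "has_hessian f H' x"
  shows "H = H'"
proof -
  obtain h where h: "\<forall>\<^sub>F z in nhds x. GDERIV f z :> h z" "(h has_derivative (\<lambda>v. H *v v)) (at x)"
    using assms(1) by (auto simp: has_hessian_def)
  obtain h' where h': "\<forall>\<^sub>F z in nhds x. GDERIV f z :> h' z" "(h' has_derivative (\<lambda>v. H' *v v)) (at x)"
    using assms(2) by (auto simp: has_hessian_def)
  have eq: "a = b" if "GDERIV f z :> a" "GDERIV f z :> b" for z a b
  proof -
    have "(\<lambda>v. v \<bullet> a) = (\<lambda>v. v \<bullet> b)"
      using that unfolding gderiv_def by (rule has_derivative_unique)
    then show ?thesis by (metis vector_eq_ldot)
  qed
  have ev: "\<forall>\<^sub>F z in nhds x. h z = h' z"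
    using h(1) h'(1) by eventually_elim (rule eq)
  have "(h' has_derivative (\<lambda>v. H *v v)) (at x)"
    using h(2)
  proof (rule has_derivative_transform_eventually)
    show "\<forall>\<^sub>F z in at x. h z = h' z"
      using ev by (simp add: eventually_at_filter eventually_mono)
  qed (use eventually_nhds_x_imp_x[OF ev] in auto)
  then have "(\<lambda>v. H *v v) = (\<lambda>v. H' *v v)"
    using h'(2) by (rule has_derivative_unique)
  then show ?thesis by (metis matrix_eq)
qed

lemma hessian_eqI: "has_hessian f H x \<Longrightarrow> hessian f x = H"
  unfolding hessian_def by (blast intro: the_equality has_hessian_unique)

text \<open>The points of \<open>Y\<close> are enumerated by \<open>y :: 'k \<Rightarrow> real ^ 'n\<close>, so \<open>N = CARD('k)\<close>, and
  \<open>\<mu>\<^sub>k = pmf \<mu> (y k)\<close>. Cost functions have a meaning on \<open>X \<times> Y\<close> only; set integrals over \<open>X\<close> keep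
  values of \<open>c\<close> outside \<open>X\<close> irrelevant.\<close>

definition dual_functional ::
  "(real ^ 'n) set \<Rightarrow> (real ^ 'n) measure \<Rightarrow> ('k::finite \<Rightarrow> real ^ 'n) \<Rightarrow> (real ^ 'n) pmf \<Rightarrow>
   (real ^ 'n \<Rightarrow> real ^ 'n \<Rightarrow> real) \<Rightarrow> real ^ 'k \<Rightarrow> real \<Rightarrow> real" where
  "dual_functional X \<rho> y \<mu> c \<psi> t =
     (LINT x:X|\<rho>. (1 - t) * ln (\<Sum>k\<in>UNIV. exp ((\<psi> $ k - t * c x (y k)) / (1 - t))))
       - (\<Sum>k\<in>UNIV. \<psi> $ k * pmf \<mu> (y k)) - (1 - t)"

definition cost_norm ::
  "(real ^ 'n) set \<Rightarrow> (real ^ 'n) set \<Rightarrow> (real ^ 'n \<Rightarrow> real ^ 'n \<Rightarrow> real) \<Rightarrow> real" where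
  "cost_norm X Y c = (SUP (x, z)\<in>X \<times> Y. \<bar>c x z\<bar>)"

definition potentials ::
  "(real ^ 'n) set \<Rightarrow> (real ^ 'n) set \<Rightarrow> (real ^ 'n \<Rightarrow> real ^ 'n \<Rightarrow> real) \<Rightarrow> (real ^ 'k) set" where
  "potentials X Y c = {\<psi>. infnorm \<psi> \<le> 2 * cost_norm X Y c \<and> (\<Sum>i\<in>UNIV. \<psi> $ i) = 0}"

definition gibbs ::
  "('k::finite \<Rightarrow> real ^ 'n) \<Rightarrow> (real ^ 'n \<Rightarrow> real ^ 'n \<Rightarrow> real) \<Rightarrow> real ^ 'k \<Rightarrow> real \<Rightarrow>
   real ^ 'n \<Rightarrow> real ^ 'k" where
  "gibbs y c \<psi> t x =
     (\<chi> i. exp ((\<psi> $ i - t * c x (y i)) / (1 - t)) /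
            (\<Sum>k\<in>UNIV. exp ((\<psi> $ k - t * c x (y k)) / (1 - t))))"

definition gibbs_covariance ::
  "(real ^ 'n) set \<Rightarrow> (real ^ 'n) measure \<Rightarrow> ('k::finite \<Rightarrow> real ^ 'n) \<Rightarrow>
   (real ^ 'n \<Rightarrow> real ^ 'n \<Rightarrow> real) \<Rightarrow> real ^ 'k \<Rightarrow> real \<Rightarrow> real ^ 'k ^ 'k" where
  "gibbs_covariance X \<rho> y c \<psi> t =
     (\<chi> i j. 1 / (1 - t) *
        (LINT x:X|\<rho>. (if i = j then gibbs y c \<psi> t x $ i else 0)
                      - gibbs y c \<psi> t x $ i * gibbs y c \<psi> t x $ j))"

text \<open>On a convex \<open>X\<close> with nonempty interior (automatic when \<open>X\<close> carries an absolutely continuous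
  probability measure) derivatives within \<open>X\<close> are unique, so \<open>g\<close> is the gradient of \<open>f\<close> on all of
  \<open>X\<close>, boundary included.\<close>

definition C1_on_with_gradient ::
  "(real ^ 'n) set \<Rightarrow> (real ^ 'n \<Rightarrow> real) \<Rightarrow> (real ^ 'n \<Rightarrow> real ^ 'n) \<Rightarrow> bool" where
  "C1_on_with_gradient X f g \<longleftrightarrow>
     (\<forall>x\<in>X. (f has_derivative (\<lambda>h. g x \<bullet> h)) (at x within X)) \<and> continuous_on X g"

end

theory Submission imports Defs begin

text \<open>
  Pointwise in \<open>x\<close>, the integrand of the dual functional is a log-sum-exp function of \<open>\<psi>\<close>. Its
  gradient is the Gibbs vector \<open>\<pi>(x)\<close> and its Hessian is \<open>1 / (1 - t)\<close> times the covariance matrix of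
  the probability vector \<open>\<pi>(x)\<close>. Since \<open>\<pi>(x)\<close> has entries in \<open>[0, 1]\<close> summing to 1, both derivatives
  are bounded uniformly in \<open>x\<close> and \<open>\<psi>\<close>, so dominated convergence moves them through the integral
  (\<open>has_derivative_set_integral\<close>, used once for the functional and once for its gradient). This gives
  \<open>has_hessian_dual_functional\<close>.

  For coercivity, the quadratic form of the covariance matrix at \<open>v\<close> is the variance of \<open>v\<close> under
  \<open>\<pi>(x)\<close>. If every weight is at least \<open>\<delta>\<close>, this variance dominates \<open>\<delta>\<close> times the sum of the squared
  deviations of \<open>v\<close> from its \<open>\<pi>(x)\<close>-mean; and when the entries of \<open>v\<close> sum to zero, shifting \<open>v\<close> by a
  constant can only increase the sum of squares (\<open>variance_lower_bound\<close>). A uniform \<open>\<delta>\<close> exists because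
  \<open>X\<close> is compact and the potentials are bounded: with \<open>M\<close> the sup norm of the cost, all the numbers
  \<open>\<psi>\<^sub>k - t c(x, y\<^sub>k)\<close> lie in \<open>[-3M, 3M]\<close>, so \<open>\<pi>\<^sub>i(x) \<ge> exp (-6M / (1 - t)) / N\<close>. Integrating over
  the probability measure \<open>\<rho>\<close> preserves the bound.
\<close>

section \<open>Integrals over compact sets and differentiation under the integral\<close>

lemma set_integrable_continuous_on_compact:
  fixes f :: "'a::topological_space \<Rightarrow> real"
  assumes "finite_measure M" "sets M = sets borel" "compact X" "X \<in> sets borel" "continuous_on X f"
  shows "set_integrable M X f"
proof -
  interpret finite_measure M by fact
  obtain B where B: "\<And>x. x \<in> X \<Longrightarrow> \<bar>f x\<bar> \<le> B"
    using compact_imp_bounded[OF compact_continuous_image[OF assms(5,3)]]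
    by (auto simp: bounded_iff)
  have "(\<lambda>x. indicator X x *\<^sub>R f x) \<in> borel_measurable M"
    using borel_measurable_continuous_on_indicator[OF assms(4,5)]
    by (simp add: measurable_cong_sets[OF assms(2) refl])
  moreover have "AE x in M. norm (indicator X x *\<^sub>R f x) \<le> \<bar>B\<bar>"
    using B by (intro AE_I2) (force simp: indicator_def)
  ultimately show ?thesis
    unfolding set_integrable_def by (rule integrable_const_bound[rotated])
qed

lemma set_integral_sum:
  fixes f :: "'i \<Rightarrow> 'a \<Rightarrow> real"
  assumes "\<And>i. i \<in> I \<Longrightarrow> set_integrable M A (f i)"
  shows "(LINT x:A|M. (\<Sum>i\<in>I. f i x)) = (\<Sum>i\<in>I. LINT x:A|M. f i x)"
  using assms unfolding set_lebesgue_integral_def set_integrable_def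
  by (simp add: sum_distrib_left Bochner_Integration.integral_sum)

text \<open>A uniform bound on the derivative makes the integrand Lipschitz in the parameter by the mean value
  inequality, so the remainder quotients of the first-order expansion are bounded by \<open>2 L\<close>. They tend
  to zero pointwise, and dominated convergence along sequences finishes the argument.\<close>

lemma has_derivative_set_integral:
  fixes F :: "'a::euclidean_space \<Rightarrow> 'b \<Rightarrow> real"
  assumes M: "finite_measure M"
    and int: "\<And>z. set_integrable M X (F z)"
    and int': "\<And>h. set_integrable M X (\<lambda>x. F' z0 x h)"
    and deriv: "\<And>z x. x \<in> X \<Longrightarrow> ((\<lambda>z. F z x) has_derivative F' z x) (at z)"
    and bound: "\<And>z x h. x \<in> X \<Longrightarrow> \<bar>F' z x h\<bar> \<le> L * norm h"
  shows "((\<lambda>z. LINT x:X|M. F z x) has_derivative (\<lambda>h. LINT x:X|M. F' z0 x h)) (at z0)"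
proof -
  interpret finite_measure M by fact
  have lin: "linear (F' z0 x)" if "x \<in> X" for x
    using deriv[OF that, of z0] by (rule has_derivative_linear)
  have "linear (\<lambda>h. LINT x:X|M. F' z0 x h)"
  proof
    fix h k
    have "(LINT x:X|M. F' z0 x (h + k)) = (LINT x:X|M. F' z0 x h + F' z0 x k)"
      unfolding set_lebesgue_integral_def
      by (rule Bochner_Integration.integral_cong) (auto simp: indicator_def linear_add[OF lin])
    then show "(LINT x:X|M. F' z0 x (h + k)) = (LINT x:X|M. F' z0 x h) + (LINT x:X|M. F' z0 x k)"
      by (simp add: set_integral_add int')
  next
    fix r :: real and h
    have "(LINT x:X|M. F' z0 x (r *\<^sub>R h)) = (LINT x:X|M. r *\<^sub>R F' z0 x h)"
      unfolding set_lebesgue_integral_def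
      by (rule Bochner_Integration.integral_cong) (auto simp: indicator_def linear_cmul[OF lin])
    then show "(LINT x:X|M. F' z0 x (r *\<^sub>R h)) = r *\<^sub>R (LINT x:X|M. F' z0 x h)"
      by simp
  qed
  then have bl: "bounded_linear (\<lambda>h. LINT x:X|M. F' z0 x h)"
    by (simp add: linear_conv_bounded_linear)
  have lip: "\<bar>F z x - F z0 x\<bar> \<le> \<bar>L\<bar> * norm (z - z0)" if x: "x \<in> X" for z x
  proof -
    have "norm (F z x - F z0 x) \<le> \<bar>L\<bar> * norm (z - z0)"
    proof (rule differentiable_bound[where S=UNIV and f'="\<lambda>z. F' z x"])
      fix w
      show "onorm (F' w x) \<le> \<bar>L\<bar>"
      proof (rule onorm_bound)
        fix h
        show "norm (F' w x h) \<le> \<bar>L\<bar> * norm h"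
          using order_trans[OF bound[OF x, of w h] mult_right_mono[OF abs_ge_self[of L] norm_ge_zero]] by simp
      qed simp
    qed (use deriv[OF x] in auto)
    then show ?thesis by simp
  qed
  \<comment> \<open>The remainder quotient; at \<open>z = z0\<close> it is 0 by the convention for division by 0.\<close>
  define Q where "Q z x = (F z x - F z0 x - F' z0 x (z - z0)) / norm (z - z0)" for z x
  have Qint: "set_integrable M X (Q z)" for z
    unfolding Q_def by (intro set_integrable_divide set_integral_diff int int')
  have Qeq: "(LINT x:X|M. Q z x) = ((LINT x:X|M. F z x) - (LINT x:X|M. F z0 x)
      - (LINT x:X|M. F' z0 x (z - z0))) / norm (z - z0)" for z
    unfolding Q_def by (simp add: set_integral_diff int int')
  have Qbd: "\<bar>Q z x\<bar> \<le> 2 * \<bar>L\<bar>" if "x \<in> X" for z x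
  proof (cases "z = z0")
    case False
    have "\<bar>F' z0 x (z - z0)\<bar> \<le> \<bar>L\<bar> * norm (z - z0)"
      using order_trans[OF bound[OF that] mult_right_mono[OF abs_ge_self[of L] norm_ge_zero]] .
    then have "\<bar>F z x - F z0 x - F' z0 x (z - z0)\<bar> \<le> 2 * \<bar>L\<bar> * norm (z - z0)"
      using lip[OF that, of z] by linarith
    then show ?thesis using False by (simp add: Q_def field_simps)
  qed (simp add: Q_def)
  have "((\<lambda>z. LINT x:X|M. Q z x) \<longlongrightarrow> 0) (at z0)"
    unfolding tendsto_at_iff_sequentially
  proof (intro allI impI)
    fix u :: "nat \<Rightarrow> 'a" assume u: "\<forall>i. u i \<in> UNIV - {z0}" "u \<longlonglongrightarrow> z0"
    have "(\<lambda>n. LINT x|M. indicator X x *\<^sub>R Q (u n) x) \<longlonglongrightarrow> (LINT x|M. 0)"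
    proof (rule integral_dominated_convergence[where w="\<lambda>_. 2 * \<bar>L\<bar>"])
      show "(\<lambda>x. indicator X x *\<^sub>R Q (u n) x) \<in> borel_measurable M" for n
        using Qint unfolding set_integrable_def by (rule borel_measurable_integrable)
      show "AE x in M. norm (indicator X x *\<^sub>R Q (u n) x) \<le> 2 * \<bar>L\<bar>" for n
        using Qbd by (intro AE_I2) (simp add: indicator_def)
      have "(\<lambda>n. indicator X x *\<^sub>R Q (u n) x) \<longlonglongrightarrow> 0" for x
      proof (cases "x \<in> X")
        case True
        have "((\<lambda>z. norm (F z x - F z0 x - F' z0 x (z - z0)) / norm (z - z0)) \<longlongrightarrow> 0) (at z0)"
          using deriv[OF True, of z0] unfolding has_derivative_iff_norm by blast
        then have "((\<lambda>z. norm (Q z x)) \<longlongrightarrow> 0) (at z0)" by (simp add: Q_def)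
        then have "((\<lambda>z. Q z x) \<longlongrightarrow> 0) (at z0)" by (rule tendsto_norm_zero_cancel)
        then show ?thesis
          using u True unfolding tendsto_at_iff_sequentially by (simp add: comp_def)
      qed simp
      then show "AE x in M. (\<lambda>n. indicator X x *\<^sub>R Q (u n) x) \<longlonglongrightarrow> 0" by simp
    qed auto
    then show "((\<lambda>z. LINT x:X|M. Q z x) \<circ> u) \<longlonglongrightarrow> 0"
      by (simp add: comp_def set_lebesgue_integral_def)
  qed
  then have "((\<lambda>z. norm (LINT x:X|M. Q z x)) \<longlongrightarrow> 0) (at z0)" by (rule tendsto_norm_zero)
  then show ?thesis
    using bl unfolding has_derivative_iff_norm by (simp add: Qeq)
qed

section \<open>Variance of a finite probability vector\<close>

text \<open>The right-hand side is the variance of \<open>v\<close> under \<open>p\<close>, that is, the \<open>p\<close>-weighted sum of squared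
  deviations from the mean \<open>m\<close>. Replacing the weights by \<open>\<delta>\<close> leaves the unweighted sum
  of \<open>(v k - m)\<^sup>2\<close>; because \<open>v\<close> sums to zero, its cross term vanishes and only a nonnegative multiple
  of \<open>m\<^sup>2\<close> is added to the sum of \<open>(v k)\<^sup>2\<close>.\<close>

lemma variance_lower_bound:
  fixes p v :: "'k::finite \<Rightarrow> real"
  assumes p1: "(\<Sum>k\<in>UNIV. p k) = 1" and \<delta>: "0 \<le> \<delta>" "\<And>k. \<delta> \<le> p k"
    and v: "(\<Sum>k\<in>UNIV. v k) = 0"
  shows "\<delta> * (\<Sum>k\<in>UNIV. (v k)\<^sup>2) \<le> (\<Sum>k\<in>UNIV. p k * (v k)\<^sup>2) - (\<Sum>k\<in>UNIV. p k * v k)\<^sup>2"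
proof -
  define m where "m = (\<Sum>k\<in>UNIV. p k * v k)"
  have "(\<Sum>k\<in>UNIV. (v k)\<^sup>2) \<le> (\<Sum>k\<in>UNIV. (v k)\<^sup>2) - 2 * m * (\<Sum>k\<in>UNIV. v k) + (\<Sum>k\<in>(UNIV::'k set). m\<^sup>2)"
    by (simp add: v)
  also have "\<dots> = (\<Sum>k\<in>UNIV. (v k - m)\<^sup>2)"
    by (simp add: power2_diff sum.distrib sum_subtractf sum_distrib_left sum_distrib_right algebra_simps)
  finally have "\<delta> * (\<Sum>k\<in>UNIV. (v k)\<^sup>2) \<le> \<delta> * (\<Sum>k\<in>UNIV. (v k - m)\<^sup>2)"
    using \<delta>(1) by (rule mult_left_mono)
  also have "\<dots> \<le> (\<Sum>k\<in>UNIV. p k * (v k - m)\<^sup>2)"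
    unfolding sum_distrib_left by (intro sum_mono mult_right_mono \<delta>) simp
  also have "\<dots> = (\<Sum>k\<in>UNIV. p k * (v k)\<^sup>2) - 2 * m * (\<Sum>k\<in>UNIV. p k * v k) + m\<^sup>2 * (\<Sum>k\<in>UNIV. p k)"
    by (simp add: power2_diff sum.distrib sum_subtractf sum_distrib_left sum_distrib_right algebra_simps)
  also have "\<dots> = (\<Sum>k\<in>UNIV. p k * (v k)\<^sup>2) - m\<^sup>2"
    by (simp add: m_def[symmetric] p1 power2_eq_square)
  finally show ?thesis by (simp add: m_def)
qed

section \<open>Gibbs weights and their derivatives\<close>

lemma partition_pos: "0 < (\<Sum>k\<in>(UNIV::'k::finite set). exp (u k :: real))"
  by (rule sum_pos) auto

lemma partition_neq_0: "(\<Sum>k\<in>(UNIV::'k::finite set). exp (u k :: real)) \<noteq> 0"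
  using partition_pos[of u] by simp

lemma gibbs_nonneg: "0 \<le> gibbs y c \<psi> t x $ i"
  by (simp add: gibbs_def sum_nonneg)

lemma sum_gibbs: "(\<Sum>i\<in>UNIV. gibbs y c \<psi> t x $ i) = 1"
  using partition_pos[of "\<lambda>k. (\<psi> $ k - t * c x (y k)) / (1 - t)"]
  by (simp add: gibbs_def flip: sum_divide_distrib)

lemma gibbs_le_1: "gibbs y c \<psi> t x $ i \<le> 1"
  using member_le_sum[of i UNIV "\<lambda>i. gibbs y c \<psi> t x $ i"] by (simp add: gibbs_nonneg sum_gibbs)

lemma gibbs_average_bound: "\<bar>\<Sum>i\<in>UNIV. gibbs y c \<psi> t x $ i * h $ i\<bar> \<le> norm h"
proof -
  have "\<bar>\<Sum>i\<in>UNIV. gibbs y c \<psi> t x $ i * h $ i\<bar> \<le> (\<Sum>i\<in>UNIV. gibbs y c \<psi> t x $ i * norm h)"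
    by (rule order_trans[OF sum_abs], rule sum_mono)
      (simp add: abs_mult gibbs_nonneg mult_left_mono component_le_norm_cart)
  then show ?thesis by (simp add: sum_gibbs flip: sum_distrib_right)
qed

text \<open>The numerator is at least \<open>exp (- B / (1 - t))\<close>, and each of the \<open>N\<close> terms of the denominator is
  at most \<open>exp (B / (1 - t))\<close>.\<close>

lemma gibbs_lower_bound:
  fixes y :: "'k::finite \<Rightarrow> real ^ 'n"
  assumes "t < 1" "\<And>k. \<bar>\<psi> $ k - t * c x (y k)\<bar> \<le> B"
  shows "exp (- (2 * B) / (1 - t)) / CARD('k) \<le> gibbs y c \<psi> t x $ i"
proof -
  let ?u = "\<lambda>k. (\<psi> $ k - t * c x (y k)) / (1 - t)"
  have u: "- B / (1 - t) \<le> ?u k" "?u k \<le> B / (1 - t)" for k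
    using assms(2)[of k] assms(1) by (auto intro!: divide_right_mono simp: abs_le_iff simp del: divide_minus_left minus_divide_left)
  have S: "(\<Sum>k\<in>UNIV. exp (?u k)) \<le> CARD('k) * exp (B / (1 - t))"
    using sum_bounded_above[of UNIV "\<lambda>k. exp (?u k)" "exp (B / (1 - t))"] u(2) by simp
  have "exp (- (2 * B) / (1 - t)) = exp (- B / (1 - t)) / exp (B / (1 - t))"
    by (simp add: exp_diff[symmetric] diff_divide_distrib[symmetric])
  then have "exp (- (2 * B) / (1 - t)) / CARD('k)
      = exp (- B / (1 - t)) / (CARD('k) * exp (B / (1 - t)))"
    by simp
  also have "\<dots> \<le> exp (?u i) / (\<Sum>k\<in>UNIV. exp (?u k))"
    using u(1) S partition_pos[of ?u] by (intro frac_le) auto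
  finally show ?thesis by (simp add: gibbs_def)
qed

lemma has_derivative_gibbs_weight:
  fixes \<psi> :: "real ^ 'k"
  assumes "t < 1"
  shows "((\<lambda>\<phi>. exp ((\<phi> $ k - t * c x (y k)) / (1 - t))) has_derivative
           (\<lambda>h. exp ((\<psi> $ k - t * c x (y k)) / (1 - t)) * (h $ k / (1 - t)))) (at \<psi>)"
proof -
  have nth: "((\<lambda>\<phi>. \<phi> $ k) has_derivative (\<lambda>h. h $ k)) (at \<psi>)"
    using bounded_linear_vec_nth by (rule bounded_linear_imp_has_derivative)
  show ?thesis
    using assms by (auto intro!: derivative_eq_intros nth)
qed

lemma has_derivative_log_sum_exp:
  assumes "t < 1"
  shows "((\<lambda>\<phi>. (1 - t) * ln (\<Sum>k\<in>UNIV. exp ((\<phi> $ k - t * c x (y k)) / (1 - t))))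
           has_derivative (\<lambda>h. \<Sum>i\<in>UNIV. gibbs y c \<psi> t x $ i * h $ i)) (at \<psi>)"
proof -
  let ?w = "\<lambda>k. exp ((\<psi> $ k - t * c x (y k)) / (1 - t))"
  let ?S = "\<Sum>k\<in>UNIV. ?w k"
  have S: "0 < ?S" by (rule partition_pos)
  note w = has_derivative_gibbs_weight[OF assms]
  have "((\<lambda>\<phi>. (1 - t) * ln (\<Sum>k\<in>UNIV. exp ((\<phi> $ k - t * c x (y k)) / (1 - t))))
      has_derivative (\<lambda>h. (1 - t) * ((\<Sum>k\<in>UNIV. ?w k * (h $ k / (1 - t))) * (1 / ?S)))) (at \<psi>)"
    using S by (intro has_derivative_mult_right DERIV_compose_FDERIV[OF DERIV_ln_divide] w has_derivative_sum)
  moreover have "(1 - t) * ((\<Sum>k\<in>UNIV. ?w k * (h $ k / (1 - t))) * (1 / ?S))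
      = (\<Sum>i\<in>UNIV. gibbs y c \<psi> t x $ i * h $ i)" for h
  proof -
    have "(\<Sum>k\<in>UNIV. ?w k * (h $ k / (1 - t))) = (\<Sum>k\<in>UNIV. ?w k * h $ k) / (1 - t)"
      by (simp add: sum_divide_distrib)
    then show ?thesis
      using assms by (simp add: gibbs_def flip: sum_divide_distrib)
  qed
  ultimately show ?thesis by simp
qed

lemma has_derivative_gibbs:
  assumes "t < 1"
  shows "((\<lambda>\<phi>. gibbs y c \<phi> t x $ i) has_derivative
           (\<lambda>h. gibbs y c \<psi> t x $ i * (h $ i - (\<Sum>j\<in>UNIV. gibbs y c \<psi> t x $ j * h $ j)) / (1 - t)))
           (at \<psi>)"
proof -
  let ?w = "\<lambda>k. exp ((\<psi> $ k - t * c x (y k)) / (1 - t))"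
  let ?S = "\<Sum>k\<in>UNIV. ?w k"
  have S: "0 < ?S" by (rule partition_pos)
  note w = has_derivative_gibbs_weight[OF assms]
  have "((\<lambda>\<phi>. exp ((\<phi> $ i - t * c x (y i)) / (1 - t)) / (\<Sum>k\<in>UNIV. exp ((\<phi> $ k - t * c x (y k)) / (1 - t))))
      has_derivative (\<lambda>h. (?w i * (h $ i / (1 - t)) * ?S - ?w i * (\<Sum>j\<in>UNIV. ?w j * (h $ j / (1 - t)))) / (?S * ?S))) (at \<psi>)"
    using S by (intro has_derivative_divide' w has_derivative_sum) auto
  moreover have "(?w i * (h $ i / (1 - t)) * ?S - ?w i * (\<Sum>j\<in>UNIV. ?w j * (h $ j / (1 - t)))) / (?S * ?S)
      = gibbs y c \<psi> t x $ i * (h $ i - (\<Sum>j\<in>UNIV. gibbs y c \<psi> t x $ j * h $ j)) / (1 - t)" for h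
  proof -
    have 1: "(\<Sum>j\<in>UNIV. gibbs y c \<psi> t x $ j * h $ j) = (\<Sum>j\<in>UNIV. ?w j * h $ j) / ?S"
      by (simp add: gibbs_def sum_divide_distrib)
    have 2: "(\<Sum>j\<in>UNIV. ?w j * (h $ j / (1 - t))) = (\<Sum>j\<in>UNIV. ?w j * h $ j) / (1 - t)"
      by (simp add: sum_divide_distrib)
    have 3: "gibbs y c \<psi> t x $ i = ?w i / ?S" by (simp add: gibbs_def)
    have "(a * (b / s) * S - a * (T / s)) / (S * S) = (a / S) * (b - T / S) / s"
      if "S \<noteq> 0" "s \<noteq> 0" for a b s S T :: real
      using that by (simp add: field_simps)
    then show ?thesis unfolding 1 2 3 using S assms by simp
  qed
  ultimately show ?thesis by (simp add: gibbs_def)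
qed

section \<open>The Hessian of the dual functional\<close>

locale compact_cost = prob_space \<rho>
  for \<rho> :: "(real ^ 'n) measure" +
  fixes X :: "(real ^ 'n) set" and y :: "'k::finite \<Rightarrow> real ^ 'n"
    and c :: "real ^ 'n \<Rightarrow> real ^ 'n \<Rightarrow> real" and t :: real
  assumes sets_\<rho>: "sets \<rho> = sets borel"
    and compact_X: "compact X"
    and cont_c: "\<And>k. continuous_on X (\<lambda>x. c x (y k))"
    and t: "t < 1"
begin

lemma integrable_continuous_on: "continuous_on X f \<Longrightarrow> set_integrable \<rho> X (f :: _ \<Rightarrow> real)"
  using set_integrable_continuous_on_compact[OF finite_measure_axioms sets_\<rho> compact_X] compact_X
  by (simp add: borel_closed compact_imp_closed)

lemma continuous_on_partition:
  "continuous_on X (\<lambda>x. \<Sum>k\<in>UNIV. exp ((\<psi> $ k - t * c x (y k)) / (1 - t)))"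
  using t by (intro continuous_intros cont_c) auto

lemma continuous_on_gibbs: "continuous_on X (\<lambda>x. gibbs y c \<psi> t x $ i)"
  unfolding gibbs_def vec_lambda_beta
  using t by (intro continuous_intros cont_c continuous_on_partition) (auto simp: partition_neq_0)

lemma gderiv_dual_functional:
  "GDERIV (\<lambda>\<phi>. dual_functional X \<rho> y \<mu> c \<phi> t) \<psi>
     :> (\<chi> i. (LINT x:X|\<rho>. gibbs y c \<psi> t x $ i) - pmf \<mu> (y i))"
proof -
  have "((\<lambda>\<phi>. LINT x:X|\<rho>. (1 - t) * ln (\<Sum>k\<in>UNIV. exp ((\<phi> $ k - t * c x (y k)) / (1 - t))))
      has_derivative (\<lambda>h. LINT x:X|\<rho>. \<Sum>i\<in>UNIV. gibbs y c \<psi> t x $ i * h $ i)) (at \<psi>)"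
  proof (rule has_derivative_set_integral[where L=1 and F'="\<lambda>\<psi> x h. \<Sum>i\<in>UNIV. gibbs y c \<psi> t x $ i * h $ i"])
    show "finite_measure \<rho>" by (rule finite_measure_axioms)
    show "set_integrable \<rho> X (\<lambda>x. (1 - t) * ln (\<Sum>k\<in>UNIV. exp ((\<phi> $ k - t * c x (y k)) / (1 - t))))" for \<phi>
      by (intro integrable_continuous_on continuous_on_mult continuous_on_ln
            continuous_on_partition continuous_on_const) (simp add: partition_neq_0)
    show "set_integrable \<rho> X (\<lambda>x. \<Sum>i\<in>UNIV. gibbs y c \<psi> t x $ i * h $ i)" for h
      by (intro integrable_continuous_on continuous_intros continuous_on_gibbs)
  qed (use gibbs_average_bound has_derivative_log_sum_exp[OF t] in auto)
  moreover have "((\<lambda>\<phi>. \<Sum>k\<in>UNIV. \<phi> $ k * pmf \<mu> (y k)) has_derivative (\<lambda>h. \<Sum>k\<in>UNIV. h $ k * pmf \<mu> (y k))) (at \<psi>)"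
    by (intro has_derivative_sum has_derivative_mult_left
          bounded_linear_imp_has_derivative[OF bounded_linear_vec_nth])
  ultimately have "((\<lambda>\<phi>. dual_functional X \<rho> y \<mu> c \<phi> t) has_derivative
      (\<lambda>h. (LINT x:X|\<rho>. \<Sum>i\<in>UNIV. gibbs y c \<psi> t x $ i * h $ i) - (\<Sum>k\<in>UNIV. h $ k * pmf \<mu> (y k)) - 0)) (at \<psi>)"
    unfolding dual_functional_def by (intro has_derivative_diff has_derivative_const)
  moreover have "(LINT x:X|\<rho>. \<Sum>i\<in>UNIV. gibbs y c \<psi> t x $ i * h $ i)
      = (\<Sum>i\<in>UNIV. (LINT x:X|\<rho>. gibbs y c \<psi> t x $ i) * h $ i)" for h
    by (subst set_integral_sum)
      (auto intro!: integrable_continuous_on continuous_intros continuous_on_gibbs)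
  ultimately show ?thesis
    unfolding gderiv_def by (simp add: inner_vec_def right_diff_distrib sum_subtractf mult.commute)
qed

lemma integrable_covariance_entry:
  "set_integrable \<rho> X (\<lambda>x. (if i = j then gibbs y c \<psi> t x $ i else 0)
                      - gibbs y c \<psi> t x $ i * gibbs y c \<psi> t x $ j)"
  by (cases "i = j") (auto intro!: integrable_continuous_on continuous_intros continuous_on_gibbs)

text \<open>Pairs the covariance matrix, given entrywise, with the derivative of the softmax map, whose
  \<open>i\<close>-th component in direction \<open>h\<close> is \<open>\<pi>\<^sub>i\<close> times the deviation of \<open>h\<^sub>i\<close> from the \<open>\<pi>\<close>-average
  of \<open>h\<close>.\<close>

lemma gibbs_covariance_component:
  "(gibbs_covariance X \<rho> y c \<psi> t *v h) $ i =
     (LINT x:X|\<rho>. gibbs y c \<psi> t x $ i * (h $ i - (\<Sum>j\<in>UNIV. gibbs y c \<psi> t x $ j * h $ j)) / (1 - t))"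
proof -
  let ?p = "\<lambda>x i. gibbs y c \<psi> t x $ i"
  have "?p x i * (h $ i - (\<Sum>j\<in>UNIV. ?p x j * h $ j)) / (1 - t)
      = (\<Sum>j\<in>UNIV. (1 / (1 - t)) * ((if i = j then ?p x i else 0) - ?p x i * ?p x j) * h $ j)" for x
  proof -
    have "(\<Sum>j\<in>UNIV. ((if i = j then ?p x i else 0) - ?p x i * ?p x j) * h $ j)
        = (\<Sum>j\<in>UNIV. if i = j then ?p x i * h $ j else 0) - (\<Sum>j\<in>UNIV. ?p x i * ?p x j * h $ j)"
      unfolding sum_subtractf[symmetric] by (rule sum.cong) (auto simp: algebra_simps)
    also have "\<dots> = ?p x i * (h $ i - (\<Sum>j\<in>UNIV. ?p x j * h $ j))"
      by (simp add: right_diff_distrib sum_distrib_left mult.assoc)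
    finally show ?thesis by (simp add: mult.assoc flip: sum_divide_distrib)
  qed
  then show ?thesis
    by (simp add: set_integral_sum integrable_covariance_entry matrix_vector_mult_def
          gibbs_covariance_def)
qed

text \<open>The gradient is known at every \<open>\<psi>\<close>, so it remains to differentiate each component of it under the
  integral. The weight is at most 1 and the deviation of \<open>h\<^sub>i\<close> from an average of entries of \<open>h\<close> at most
  twice the norm of \<open>h\<close>, which gives the uniform bound \<open>2 / (1 - t)\<close>.\<close>

lemma has_hessian_dual_functional:
  "has_hessian (\<lambda>\<phi>. dual_functional X \<rho> y \<mu> c \<phi> t) (gibbs_covariance X \<rho> y c \<psi> t) \<psi>"
proof -
  let ?g = "\<lambda>\<psi>. \<chi> i. (LINT x:X|\<rho>. gibbs y c \<psi> t x $ i) - pmf \<mu> (y i)"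
  let ?D = "\<lambda>i \<psi> x h. gibbs y c \<psi> t x $ i * (h $ i - (\<Sum>j\<in>UNIV. gibbs y c \<psi> t x $ j * h $ j)) / (1 - t)"
  have bound: "\<bar>?D i \<psi> x h\<bar> \<le> 2 / (1 - t) * norm h" for i \<psi> x h
  proof -
    have "\<bar>h $ i - (\<Sum>j\<in>UNIV. gibbs y c \<psi> t x $ j * h $ j)\<bar> \<le> 2 * norm h"
      using component_le_norm_cart[of h i] gibbs_average_bound[of y c \<psi> t x h] by linarith
    then have "\<bar>gibbs y c \<psi> t x $ i\<bar> * \<bar>h $ i - (\<Sum>j\<in>UNIV. gibbs y c \<psi> t x $ j * h $ j)\<bar> \<le> 1 * (2 * norm h)"
      by (intro mult_mono) (auto simp: gibbs_le_1 gibbs_nonneg)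
    then show ?thesis using t by (simp add: abs_mult divide_right_mono)
  qed
  have "((\<lambda>\<phi>. LINT x:X|\<rho>. gibbs y c \<phi> t x $ i) has_derivative (\<lambda>h. LINT x:X|\<rho>. ?D i \<psi> x h)) (at \<psi>)" for i
    using t
    by (intro has_derivative_set_integral[where F'="?D i" and L="2 / (1 - t)"] finite_measure_axioms
          integrable_continuous_on continuous_intros continuous_on_gibbs has_derivative_gibbs bound) auto
  then have "(?g has_derivative (\<lambda>h. gibbs_covariance X \<rho> y c \<psi> t *v h)) (at \<psi>)"
    by (subst has_derivative_componentwise_within)
      (auto simp: Basis_vec_def inner_axis gibbs_covariance_component
        intro!: derivative_eq_intros)
  then show ?thesis
    unfolding has_hessian_def using gderiv_dual_functional[of \<mu>] by (intro exI[of _ ?g]) simp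
qed

section \<open>Coercivity on vectors of zero sum\<close>

text \<open>The quadratic form is the integral over \<open>X\<close> of the variance of \<open>v\<close> under the Gibbs weights, divided
  by \<open>1 - t\<close>, so the pointwise variance bound integrates to the claim.\<close>

lemma gibbs_covariance_coercive:
  assumes X: "measure \<rho> X = 1"
    and \<delta>: "0 \<le> \<delta>" "\<And>x i. x \<in> X \<Longrightarrow> \<delta> \<le> gibbs y c \<psi> t x $ i"
    and v: "(\<Sum>k\<in>UNIV. v $ k) = 0"
  shows "\<delta> / (1 - t) * (norm v)\<^sup>2 \<le> v \<bullet> (gibbs_covariance X \<rho> y c \<psi> t *v v)"
proof -
  let ?p = "\<lambda>x i. gibbs y c \<psi> t x $ i"
  let ?V = "\<lambda>x. (\<Sum>i\<in>UNIV. ?p x i * (v $ i)\<^sup>2) - (\<Sum>i\<in>UNIV. ?p x i * v $ i)\<^sup>2"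
  have nv: "(norm v)\<^sup>2 = (\<Sum>i\<in>UNIV. (v $ i)\<^sup>2)"
    unfolding power2_norm_eq_inner inner_vec_def by (simp add: power2_eq_square)
  have Xs: "X \<in> sets \<rho>"
    using compact_X by (simp add: sets_\<rho> borel_closed compact_imp_closed)
  have "\<delta> / (1 - t) * (norm v)\<^sup>2 = (LINT x:X|\<rho>. \<delta> * (norm v)\<^sup>2 / (1 - t))"
    using X Xs by (simp add: set_lebesgue_integral_def)
  also have "\<dots> \<le> (LINT x:X|\<rho>. ?V x / (1 - t))"
  proof (rule set_integral_mono)
    show "\<delta> * (norm v)\<^sup>2 / (1 - t) \<le> ?V x / (1 - t)" if "x \<in> X" for x
      unfolding nv using variance_lower_bound[OF sum_gibbs \<delta>(1) \<delta>(2)[OF that] v] t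
      by (intro divide_right_mono) auto
  qed (use t in \<open>intro integrable_continuous_on continuous_intros continuous_on_gibbs; simp\<close>)+
  also have "(\<lambda>x. ?V x / (1 - t)) = (\<lambda>x. \<Sum>i\<in>UNIV. v $ i * (?p x i * (v $ i - (\<Sum>j\<in>UNIV. ?p x j * v $ j)) / (1 - t)))"
    by (simp add: sum_divide_distrib[symmetric] right_diff_distrib sum_subtractf power2_eq_square
          sum_distrib_left sum_distrib_right mult_ac)
  also have "set_lebesgue_integral \<rho> X \<dots> = v \<bullet> (gibbs_covariance X \<rho> y c \<psi> t *v v)"
    using t
    by (subst set_integral_sum)
      (auto simp: inner_vec_def gibbs_covariance_component
        intro!: integrable_continuous_on continuous_intros continuous_on_gibbs)
  finally show ?thesis .
qed

end

text \<open>The point is that the supremum defining the norm is over a bounded set: it is a finite union of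
  continuous images of the compact set \<open>X\<close>.\<close>

lemma abs_cost_le_cost_norm:
  fixes y :: "'k::finite \<Rightarrow> real ^ 'n"
  assumes "compact X" "\<And>k. continuous_on X (\<lambda>x. c x (y k))" "x \<in> X"
  shows "\<bar>c x (y k)\<bar> \<le> cost_norm X (range y) c"
proof -
  have "bounded (\<Union>k. (\<lambda>x. c x (y k)) ` X)"
    using assms by (intro bounded_UN) (auto intro: compact_imp_bounded compact_continuous_image)
  then obtain B where "\<And>x k. x \<in> X \<Longrightarrow> \<bar>c x (y k)\<bar> \<le> B"
    unfolding bounded_iff by auto
  then have "bdd_above ((\<lambda>(x, z). \<bar>c x z\<bar>) ` (X \<times> range y))"
    by (intro bdd_aboveI[of _ B]) auto
  then have "(\<lambda>(x, z). \<bar>c x z\<bar>) (x, y k) \<le> cost_norm X (range y) c"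
    unfolding cost_norm_def using assms(3) by (intro cSUP_upper) auto
  then show ?thesis by simp
qed

theorem theorem2p6:
  fixes X :: "(real ^ 'n) set"
    and y :: "'k::finite \<Rightarrow> real ^ 'n"
    and \<rho> :: "(real ^ 'n) measure"
    and d :: "real ^ 'n \<Rightarrow> real"
    and m_low m_up \<mu>_low :: real
    and \<mu> :: "(real ^ 'n) pmf"
    and c :: "real ^ 'n \<Rightarrow> real ^ 'n \<Rightarrow> real"
    and grad_c :: "real ^ 'n \<Rightarrow> real ^ 'n \<Rightarrow> real ^ 'n"
  assumes "compact X" and "convex X"
    and "inj y"
    and "prob_space \<rho>"
    and "set_borel_measurable lborel X d"
    and "\<rho> = density lborel (\<lambda>x. ennreal (indicator X x * d x))"
    and "0 < m_low" and "\<And>x. x \<in> X \<Longrightarrow> m_low \<le> d x \<and> d x \<le> m_up"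
    and "set_pmf \<mu> \<subseteq> range y"
    and "0 < \<mu>_low" and "\<And>k. \<mu>_low \<le> pmf \<mu> (y k)"
    and "\<And>k. C1_on_with_gradient X (\<lambda>x. c x (y k)) (\<lambda>x. grad_c x (y k))"
    and "\<And>x. x \<in> X \<Longrightarrow> inj_on (grad_c x) (range y)"
  shows "\<forall>t\<in>{0..<1}. \<exists>C>0. \<forall>\<psi>\<in>potentials X (range y) c.
           has_hessian (\<lambda>\<phi>. dual_functional X \<rho> y \<mu> c \<phi> t) (gibbs_covariance X \<rho> y c \<psi> t) \<psi> \<and>
           (\<forall>v. (\<Sum>k\<in>UNIV. v $ k) = 0 \<longrightarrow>
              v \<bullet> (hessian (\<lambda>\<phi>. dual_functional X \<rho> y \<mu> c \<phi> t) \<psi> *v v) \<ge> C * (norm v)\<^sup>2)"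
proof
  fix t :: real assume t01: "t \<in> {0..<1}"
  have cont: "continuous_on X (\<lambda>x. c x (y k))" for k
    using assms(12)[of k] unfolding C1_on_with_gradient_def
    by (auto intro: has_derivative_continuous_on)
  interpret compact_cost \<rho> X y c t
    using assms(4) cont t01 \<open>compact X\<close>
    by (auto simp: compact_cost_def compact_cost_axioms_def assms(6))
  have Xs: "X \<in> sets borel" using \<open>compact X\<close> by (simp add: borel_closed compact_imp_closed)
  have dm: "(\<lambda>x. ennreal (indicator X x * d x)) \<in> borel_measurable lborel"
    using assms(5) by (simp add: set_borel_measurable_def)
  have "AE x in \<rho>. x \<in> X"
    unfolding assms(6) AE_density[OF dm] by (rule AE_I2) (simp add: indicator_def)
  then have X1: "measure \<rho> X = 1"
    using Xs by (intro prob_eq_1[THEN iffD2]) (simp_all add: sets_\<rho>)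
  \<comment> \<open>With \<open>M\<close> the cost norm, \<open>\<bar>\<psi>\<^sub>k - t c\<bar> \<le> 2M + M\<close> because \<open>0 \<le> t < 1\<close>.\<close>
  define \<delta> where "\<delta> = exp (- (2 * (3 * cost_norm X (range y) c)) / (1 - t)) / CARD('k)"
  have \<delta>: "0 < \<delta>" by (simp add: \<delta>_def)
  show "\<exists>C>0. \<forall>\<psi>\<in>potentials X (range y) c.
           has_hessian (\<lambda>\<phi>. dual_functional X \<rho> y \<mu> c \<phi> t) (gibbs_covariance X \<rho> y c \<psi> t) \<psi> \<and>
           (\<forall>v. (\<Sum>k\<in>UNIV. v $ k) = 0 \<longrightarrow>
              v \<bullet> (hessian (\<lambda>\<phi>. dual_functional X \<rho> y \<mu> c \<phi> t) \<psi> *v v) \<ge> C * (norm v)\<^sup>2)"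
  proof (intro exI[of _ "\<delta> / (1 - t)"] conjI ballI allI impI)
    show "0 < \<delta> / (1 - t)" using \<delta> t by simp
  next
    fix \<psi> :: "real ^ 'k" assume "\<psi> \<in> potentials X (range y) c"
    show "has_hessian (\<lambda>\<phi>. dual_functional X \<rho> y \<mu> c \<phi> t) (gibbs_covariance X \<rho> y c \<psi> t) \<psi>"
      by (rule has_hessian_dual_functional)
  next
    fix \<psi> v :: "real ^ 'k" assume \<psi>: "\<psi> \<in> potentials X (range y) c" and v: "(\<Sum>k\<in>UNIV. v $ k) = (0::real)"
    have "\<delta> \<le> gibbs y c \<psi> t x $ i" if x: "x \<in> X" for x i
      unfolding \<delta>_def
    proof (rule gibbs_lower_bound)
      fix k
      have "\<bar>\<psi> $ k\<bar> \<le> 2 * cost_norm X (range y) c"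
        using \<psi> component_le_infnorm_cart[of \<psi> k] by (simp add: potentials_def)
      moreover have "\<bar>t * c x (y k)\<bar> \<le> 1 * cost_norm X (range y) c"
        unfolding abs_mult using t01 abs_cost_le_cost_norm[of X c y x k, OF \<open>compact X\<close> cont x]
        by (intro mult_mono) auto
      ultimately show "\<bar>\<psi> $ k - t * c x (y k)\<bar> \<le> 3 * cost_norm X (range y) c" by linarith
    qed (use t in simp)
    then show "\<delta> / (1 - t) * (norm v)\<^sup>2 \<le> v \<bullet> (hessian (\<lambda>\<phi>. dual_functional X \<rho> y \<mu> c \<phi> t) \<psi> *v v)"
      unfolding hessian_eqI[OF has_hessian_dual_functional]
      using \<delta> v X1 by (intro gibbs_covariance_coercive) auto
  qed
qed

end
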